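(* Let $G$ be a connected interval graph and let $\omega(G)$ be the maximum size of a clique of $G$. If every maximum clique of $G$ contains a simplicial vertex, then $h(G)=mh(G)=\omega(G)-1$. Otherwise, $mh(G)=\omega(G)$.
   Context: An interval graph is the intersection graph of a set of intervals of the real line. A vertex is simplicial if its neighbourhood induces a clique. Hunters and Rabbit game on a graph $G=(V,E)$. A hunter strategy is a finite sequence $(S_1,\dots,S_\ell)$ of non-empty subsets of $V$, using $\max_i|S_i|$ hunters. A rabbit trajectory is a walk $(r_0,\dots,r_\ell)$ in $G$ ($r_i\in N(r_{i-1})$); the strategy is winning if every rabbit trajectory has some $j<\ell$ with $r_j\in S_{j+1}$. $h(G)$ is the minimum number of hunters of a winning hunter strategy ($0$ for a single vertex). Contaminated sets: $Z_0=V$, $Z_i=\{x : \exists y\in Z_{i-1}\setminus S_i,\ xy\in E\}$. A vertex $v$ is cleared at round $i$ if $v\in S_i$, or $N(v)\cap Z_{i-1}\ne\emptyset$ and $N(v)\cap Z_{i-1}\subseteq S_i$. A strategy is monotone if any vertex $v$ cleared at some round $i$ satisfies $v\in S_{j+1}$ whenever $j>i$ and $v\in Z_j$. $mh(G)$ is the minimum number of hunters of a monotone winning hunter strategy ($0$ for a single vertex). *)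

theory Defs
  imports "HOL-Analysis.Analysis" "Graph_Theory.Digraph_Component"
begin

text \<open>
  Finite simple graphs are the symmetric loop-free pair digraphs of the locale
  \<^locale>\<open>pair_graph\<close>: an undirected edge is a pair of opposite arcs.
\<close>

definition neighbourhood :: "'a pair_pre_digraph \<Rightarrow> 'a \<Rightarrow> 'a set" where
  "neighbourhood G v = {u. (v, u) \<in> parcs G}"

text \<open>
  Intersection graphs of families of intervals: distinct vertices may receive equal intervals.
  Open, half-open, degenerate and unbounded intervals are all allowed, the empty set is not.
\<close>

definition interval_representation :: "'a pair_pre_digraph \<Rightarrow> ('a \<Rightarrow> real set) \<Rightarrow> bool" where
  "interval_representation G I \<longleftrightarrow>
     (\<forall>v\<in>pverts G. is_interval (I v) \<and> I v \<noteq> {}) \<and>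
     (\<forall>u\<in>pverts G. \<forall>v\<in>pverts G. u \<noteq> v \<longrightarrow> ((u, v) \<in> parcs G \<longleftrightarrow> I u \<inter> I v \<noteq> {}))"

definition interval_graph :: "'a pair_pre_digraph \<Rightarrow> bool" where
  "interval_graph G \<longleftrightarrow> (\<exists>I. interval_representation G I)"

definition clique :: "'a pair_pre_digraph \<Rightarrow> 'a set \<Rightarrow> bool" where
  "clique G K \<longleftrightarrow> K \<subseteq> pverts G \<and> (\<forall>u\<in>K. \<forall>v\<in>K. u \<noteq> v \<longrightarrow> (u, v) \<in> parcs G)"

definition clique_number :: "'a pair_pre_digraph \<Rightarrow> nat" where
  "clique_number G = Max {card K | K. clique G K}"

definition maximum_clique :: "'a pair_pre_digraph \<Rightarrow> 'a set \<Rightarrow> bool" where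
  "maximum_clique G K \<longleftrightarrow> clique G K \<and> card K = clique_number G"

definition simplicial :: "'a pair_pre_digraph \<Rightarrow> 'a \<Rightarrow> bool" where
  "simplicial G v \<longleftrightarrow> v \<in> pverts G \<and> clique G (neighbourhood G v)"

text \<open>
  A strategy \<open>(S\<^sub>1, \<dots>, S\<^sub>l)\<close> is a list, so \<open>S\<^sub>i\<close> is \<open>S ! (i - 1)\<close> and \<open>S\<^sub>i\<^sub>+\<^sub>1\<close> is \<open>S ! i\<close>.
\<close>

definition hunter_strategy :: "'a pair_pre_digraph \<Rightarrow> 'a set list \<Rightarrow> bool" where
  "hunter_strategy G S \<longleftrightarrow> S \<noteq> [] \<and> (\<forall>X\<in>set S. X \<noteq> {} \<and> X \<subseteq> pverts G)"

definition hunters_used :: "'a set list \<Rightarrow> nat" where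
  "hunters_used S = Max (card ` set S)"

text \<open>The list \<open>r = [r\<^sub>0, \<dots>, r\<^sub>l]\<close> is a walk with \<open>l\<close> steps.\<close>

definition rabbit_trajectory :: "'a pair_pre_digraph \<Rightarrow> nat \<Rightarrow> 'a list \<Rightarrow> bool" where
  "rabbit_trajectory G l r \<longleftrightarrow> length r = Suc l \<and> set r \<subseteq> pverts G \<and>
     (\<forall>i\<in>{1..l}. r ! i \<in> neighbourhood G (r ! (i - 1)))"

definition winning :: "'a pair_pre_digraph \<Rightarrow> 'a set list \<Rightarrow> bool" where
  "winning G S \<longleftrightarrow>
     (\<forall>r. rabbit_trajectory G (length S) r \<longrightarrow> (\<exists>j<length S. r ! j \<in> S ! j))"

primrec contaminated :: "'a pair_pre_digraph \<Rightarrow> 'a set list \<Rightarrow> nat \<Rightarrow> 'a set" where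
  "contaminated G S 0 = pverts G"
| "contaminated G S (Suc i) = {x. \<exists>y \<in> contaminated G S i - S ! i. (x, y) \<in> parcs G}"

definition cleared_at :: "'a pair_pre_digraph \<Rightarrow> 'a set list \<Rightarrow> nat \<Rightarrow> 'a \<Rightarrow> bool" where
  "cleared_at G S i v \<longleftrightarrow> v \<in> S ! (i - 1) \<or>
     (neighbourhood G v \<inter> contaminated G S (i - 1) \<noteq> {} \<and>
      neighbourhood G v \<inter> contaminated G S (i - 1) \<subseteq> S ! (i - 1))"

text \<open>
  The index \<open>j\<close> stops at \<open>length S - 1\<close>, because there is no \<open>S\<^sub>l\<^sub>+\<^sub>1\<close>. For a winning strategy
  the case \<open>j = length S\<close> would be vacuous, since then no vertex is contaminated after round \<open>l\<close>.
\<close>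

definition monotone_strategy :: "'a pair_pre_digraph \<Rightarrow> 'a set list \<Rightarrow> bool" where
  "monotone_strategy G S \<longleftrightarrow>
     (\<forall>v\<in>pverts G. \<forall>i\<in>{1..length S}. cleared_at G S i v \<longrightarrow>
        (\<forall>j. i < j \<and> j < length S \<and> v \<in> contaminated G S j \<longrightarrow> v \<in> S ! j))"

definition hunter_number :: "'a pair_pre_digraph \<Rightarrow> nat" where
  "hunter_number G = (if card (pverts G) = 1 then 0
     else LEAST k. \<exists>S. hunter_strategy G S \<and> winning G S \<and> hunters_used S = k)"

definition monotone_hunter_number :: "'a pair_pre_digraph \<Rightarrow> nat" where
  "monotone_hunter_number G = (if card (pverts G) = 1 then 0
     else LEAST k. \<exists>S. hunter_strategy G S \<and> winning G S \<and> monotone_strategy G S \<and>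
       hunters_used S = k)"

end

theory Submission
  imports Defs
begin

text \<open>
  Lower bounds. As long as two vertices of a clique \<open>K\<close> escape the shots, the whole of \<open>K\<close> stays
  contaminated, so \<open>card K - 1\<close> hunters are necessary. With exactly that many, the first round
  after which \<open>K\<close> is not fully contaminated shoots \<open>K - {x}\<close>. If \<open>x\<close> has a neighbour \<open>w\<close> outside
  \<open>K\<close>, then \<open>w\<close> was cleared one round earlier and is recontaminated by \<open>x\<close>, so monotonicity forces
  the next shot to contain \<open>w\<close>. Hence some \<open>y \<in> K\<close> escapes that shot, and the round after must
  shoot all of \<open>K - {y}\<close>; but then a neighbour of \<open>y\<close> outside \<open>K\<close>, which was cleared before, is
  recontaminated and not shot. In a maximum clique the vertices with a neighbour outside it are
  exactly the non-simplicial ones.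

  Upper bounds. Sweep over the bags of an interval model from left to right, shooting each bag
  twice. A vertex whose interval is a single point may be left out of its bag, and a simplicial
  vertex of a maximum clique can be given such an interval, which saves one hunter in that bag.
\<close>

subsection \<open>Contaminated sets\<close>

context pair_graph
begin

lemma contaminated_subset: "contaminated G S i \<subseteq> pverts G"
  by (cases i) (auto dest: in_arcsD1)

lemma contaminated_SucI: "\<lbrakk>y \<in> contaminated G S i; y \<notin> S ! i; (x, y) \<in> parcs G\<rbrakk> \<Longrightarrow> x \<in> contaminated G S (Suc i)"
  by auto

lemma contaminated_SucE:
  assumes "x \<in> contaminated G S (Suc i)"
  obtains y where "y \<in> contaminated G S i" "y \<notin> S ! i" "(x, y) \<in> parcs G"
  using assms by auto

lemma contaminated_empty_mono:
  assumes "contaminated G S i = {}" and "i \<le> j"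
  shows "contaminated G S j = {}"
  using assms(2,1) by (induction rule: dec_induct) auto

text \<open>With the converse below, \<open>contaminated G S i\<close> consists of the possible
  positions \<open>r ! i\<close> of a rabbit that has escaped the first \<open>i\<close>
  shots.\<close>

lemma contaminated_imp_trajectory:
  assumes "x \<in> contaminated G S i"
  shows "\<exists>r. rabbit_trajectory G i r \<and> r ! i = x \<and> (\<forall>j<i. r ! j \<notin> S ! j)"
  using assms
proof (induction i arbitrary: x)
  case 0
  then show ?case
    by (intro exI[of _ "[x]"]) (auto simp: rabbit_trajectory_def)
next
  case (Suc i)
  then obtain y where y: "y \<in> contaminated G S i" "y \<notin> S ! i" "(x, y) \<in> parcs G"
    by auto
  obtain r where r: "rabbit_trajectory G i r" "r ! i = y" "\<forall>j<i. r ! j \<notin> S ! j"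
    using Suc.IH[OF y(1)] by auto
  have len: "length r = Suc i"
    using r(1) by (simp add: rabbit_trajectory_def)
  have "(r @ [x]) ! k \<in> neighbourhood G ((r @ [x]) ! (k - 1))" if k: "k \<in> {1..Suc i}" for k
  proof (cases "k = Suc i")
    case True
    then show ?thesis
      using y(3) r(2) len by (auto simp: nth_append neighbourhood_def dest: arcs_symmetric)
  next
    case False
    then show ?thesis
      using r(1) len k by (auto simp: nth_append rabbit_trajectory_def)
  qed
  then have "rabbit_trajectory G (Suc i) (r @ [x])"
    using r(1) len in_arcsD1[OF y(3)] by (auto simp: rabbit_trajectory_def)
  moreover have "\<forall>j<Suc i. (r @ [x]) ! j \<notin> S ! j"
    using r(2,3) y(2) len by (auto simp: nth_append less_Suc_eq)
  ultimately show ?case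
    using len by (intro exI[of _ "r @ [x]"]) (simp add: nth_append)
qed

lemma trajectory_imp_contaminated:
  assumes "rabbit_trajectory G l r" and "i \<le> l" and "\<forall>j<i. r ! j \<notin> S ! j"
  shows "r ! i \<in> contaminated G S i"
  using assms(2,3)
proof (induction i)
  case 0
  then show ?case
    using assms(1) by (auto simp: rabbit_trajectory_def)
next
  case (Suc i)
  have "r ! Suc i \<in> neighbourhood G (r ! i)"
    using assms(1) Suc.prems(1) by (auto simp: rabbit_trajectory_def dest: bspec[of _ _ "Suc i"])
  then have "(r ! Suc i, r ! i) \<in> parcs G"
    by (auto simp: neighbourhood_def dest: arcs_symmetric)
  moreover have "r ! i \<in> contaminated G S i" "r ! i \<notin> S ! i"
    using Suc by auto
  ultimately show ?case
    by (intro contaminated_SucI)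
qed

lemma winning_iff: "winning G S \<longleftrightarrow> contaminated G S (length S) = {}"
proof
  assume win: "winning G S"
  show "contaminated G S (length S) = {}"
    using win contaminated_imp_trajectory[of _ S "length S"] unfolding winning_def by blast
next
  assume "contaminated G S (length S) = {}"
  then show "winning G S"
    using trajectory_imp_contaminated[of "length S" _ "length S" S]
    unfolding winning_def by blast
qed

text \<open>List entries beyond the length are unspecified, so a round must be known to exist before
  its shot can be counted. A nonempty contaminated set guarantees this.\<close>

lemma winning_less_length:
  assumes "winning G S" and "contaminated G S i \<noteq> {}"
  shows "i < length S"
  using assms contaminated_empty_mono[of S "length S" i] unfolding winning_iff by force

lemma hunters_used_le_iff: "S \<noteq> [] \<Longrightarrow> hunters_used S \<le> k \<longleftrightarrow> (\<forall>X\<in>set S. card X \<le> k)"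
  by (simp add: hunters_used_def)

lemma card_nth_le_hunters_used: "i < length S \<Longrightarrow> card (S ! i) \<le> hunters_used S"
  by (simp add: hunters_used_def)

lemma finite_strategy_nth: "\<lbrakk>hunter_strategy G S; i < length S\<rbrakk> \<Longrightarrow> finite (S ! i)"
  using finite_subset[OF _ pair_finite_verts] nth_mem[of i S] by (auto simp: hunter_strategy_def)

lemma hunters_used_pos:
  assumes "hunter_strategy G S"
  shows "1 \<le> hunters_used S"
proof -
  have "0 < length S" "S ! 0 \<noteq> {}"
    using assms by (auto simp: hunter_strategy_def)
  then show ?thesis
    using card_nth_le_hunters_used[of 0 S] finite_strategy_nth[OF assms, of 0]
    by (metis One_nat_def Suc_leI card_gt_0_iff order_less_le_trans)
qed

lemma clique_finite: "clique G K \<Longrightarrow> finite K"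
  unfolding clique_def using finite_subset[OF _ pair_finite_verts] by simp

lemma finite_clique_cards: "finite {card K |K. clique G K}"
proof -
  have "{card K |K. clique G K} \<subseteq> card ` Pow (pverts G)"
    by (auto simp: clique_def)
  then show ?thesis
    using pair_finite_verts finite_subset by blast
qed

lemma clique_card_le: "clique G K \<Longrightarrow> card K \<le> clique_number G"
  unfolding clique_number_def by (intro Max_ge finite_clique_cards) auto

lemma maximum_clique_exists: "\<exists>K. maximum_clique G K"
proof -
  have "{card K |K. clique G K} \<noteq> {}"
    by (auto intro!: exI[of _ "{}"] simp: clique_def)
  from Max_in[OF finite_clique_cards this] show ?thesis
    by (auto simp: maximum_clique_def clique_number_def)
qed

subsection \<open>Lower bounds from a clique\<close>

lemma clique_recontaminated:
  assumes "clique G K" and "x \<in> K" and "x \<in> contaminated G S i" and "x \<notin> S ! i"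
  shows "K - {x} \<subseteq> contaminated G S (Suc i)"
  using assms unfolding clique_def by (blast intro: contaminated_SucI)

text \<open>Look at the shot just before \<open>K\<close> first fails to be fully contaminated,
  which happens because the last contaminated set is empty. Two vertices of \<open>K\<close>
  escaping it would recontaminate all of \<open>K\<close>; so only \<open>x\<close> escapes, and
  shooting the others takes all hunters.\<close>

lemma clique_escape_round:
  assumes K: "clique G K" and S: "hunter_strategy G S" and win: "winning G S"
    and used: "hunters_used S \<le> card K - 1" and card: "2 \<le> card K"
  obtains x i where "x \<in> K" "i < length S" "\<forall>j\<le>i. K \<subseteq> contaminated G S j"
    "S ! i = K - {x}" "x \<notin> contaminated G S (Suc i)"
proof -
  have fin: "finite K" and ne: "K \<noteq> {}"
    using clique_finite[OF K] card by auto
  let ?P = "\<lambda>i. \<not> K \<subseteq> contaminated G S i"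
  have P: "?P (length S)"
    using win ne by (auto simp: winning_iff)
  define n where "n = (LEAST i. ?P i)"
  have n: "?P n" and before: "\<And>j. j < n \<Longrightarrow> K \<subseteq> contaminated G S j" and "n \<le> length S"
    using LeastI[of ?P, OF P] not_less_Least[of _ ?P] Least_le[of ?P, OF P] unfolding n_def by blast+
  have "n \<noteq> 0"
    using n K by (auto simp: clique_def intro: ccontr)
  then obtain i where i: "n = Suc i"
    using not0_implies_Suc by blast
  have lt: "i < length S"
    using \<open>n \<le> length S\<close> i by simp
  have sub: "K \<subseteq> contaminated G S i"
    using before i by simp
  have "card (S ! i) \<le> card K - 1"
    using card_nth_le_hunters_used[OF lt] used by simp
  then have "card (S ! i) < card K"
    using card by linarith
  then have "\<not> K \<subseteq> S ! i"
    using card_mono[OF finite_strategy_nth[OF S lt], of K] by linarith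
  then obtain x where x: "x \<in> K" "x \<notin> S ! i"
    by blast
  have esc: "y = x" if "y \<in> K" "y \<notin> S ! i" for y
  proof (rule ccontr)
    assume "y \<noteq> x"
    moreover have "K - {z} \<subseteq> contaminated G S (Suc i)" if "z \<in> {x, y}" for z
      using clique_recontaminated[OF K, of z S i] that x \<open>y \<in> K\<close> \<open>y \<notin> S ! i\<close> sub by auto
    ultimately show False
      using n i by blast
  qed
  then have "K - {x} \<subseteq> S ! i"
    by blast
  then have eq: "S ! i = K - {x}"
    using \<open>card (S ! i) \<le> card K - 1\<close> finite_strategy_nth[OF S lt] x(1) fin
    by (metis card_Diff_singleton card_seteq)
  have xn: "x \<notin> contaminated G S (Suc i)"
    using clique_recontaminated[OF K x(1) _ x(2)] sub x(1) n i by blast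
  have "\<forall>j\<le>i. K \<subseteq> contaminated G S j"
    using before i by simp
  then show ?thesis
    using that x(1) lt eq xn by blast
qed

lemma hunters_used_ge_clique:
  assumes K: "clique G K" and S: "hunter_strategy G S" and win: "winning G S"
  shows "card K - 1 \<le> hunters_used S"
proof (cases "2 \<le> card K \<and> hunters_used S \<le> card K - 1")
  case True
  then obtain x i where "x \<in> K" "i < length S" "S ! i = K - {x}"
    using clique_escape_round[OF K S win] by metis
  then show ?thesis
    using card_nth_le_hunters_used[of i S] clique_finite[OF K] by simp
next
  case False
  then show ?thesis
    using hunters_used_pos[OF S] by linarith
qed

text \<open>The contradiction comes from counting over the shots \<open>S ! i\<close>,
  \<open>S ! Suc i\<close> and \<open>S ! Suc (Suc i)\<close>, each of fewer than
  \<open>card K\<close> vertices. For \<open>cleared_at\<close>, the shot \<open>S ! i\<close> is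
  round \<open>Suc i\<close>.\<close>

lemma hunters_used_ge_monotone:
  assumes K: "clique G K" and S: "hunter_strategy G S" and win: "winning G S"
    and mono: "monotone_strategy G S"
    and out: "\<And>v. v \<in> K \<Longrightarrow> \<exists>u. (v, u) \<in> parcs G \<and> u \<notin> K"
  shows "card K \<le> hunters_used S"
proof (rule ccontr)
  assume "\<not> card K \<le> hunters_used S"
  then have used: "hunters_used S \<le> card K - 1" and card: "2 \<le> card K"
    using hunters_used_pos[OF S] by auto
  have finK: "finite K"
    by (rule clique_finite[OF K])
  have small: "card (S ! j) < card K" if "j < length S" for j
    using card_nth_le_hunters_used[OF that] used card by linarith
  have shot_again: "v \<in> S ! j"
    if "cleared_at G S r v" "1 \<le> r" "r < j" "v \<in> contaminated G S j" for v r j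
  proof -
    have "j < length S" "v \<in> pverts G"
      using winning_less_length[OF win, of j] contaminated_subset that(4) by blast+
    moreover have "r \<in> {1..length S}"
      using that \<open>j < length S\<close> by simp
    ultimately show ?thesis
      using mono that unfolding monotone_strategy_def by blast
  qed
  have inV: "K \<subseteq> pverts G"
    using K by (simp add: clique_def)
  obtain x i where x: "x \<in> K" and i: "i < length S"
    and early: "\<And>j. j \<le> i \<Longrightarrow> K \<subseteq> contaminated G S j"
    and Si: "S ! i = K - {x}" and xn: "x \<notin> contaminated G S (Suc i)"
    using clique_escape_round[OF K S win used card] by metis
  obtain w where w: "(x, w) \<in> parcs G" "w \<notin> K"
    using out[OF x] by blast
  \<comment> \<open>Otherwise \<open>w\<close>, which is outside \<open>K\<close> and hence not
    shot, would contaminate \<open>x\<close>.\<close>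
  have wi: "w \<notin> contaminated G S i"
    using xn w Si by auto
  then have "i \<noteq> 0"
    using in_arcsD2[OF w(1)] by (metis contaminated.simps(1))
  then obtain h where h: "i = Suc h"
    using not0_implies_Suc by blast
  have xh: "x \<in> contaminated G S h" "x \<in> contaminated G S i"
    using subsetD[OF early x, of h] subsetD[OF early x, of i] h by (simp_all del: contaminated.simps)
  have wx: "(w, x) \<in> parcs G"
    using w(1) by (rule arcs_symmetric)
  \<comment> \<open>All contaminated neighbours of \<open>w\<close> are shot at index
    \<open>h\<close>, among them \<open>x\<close>; so round \<open>i\<close> clears both
    \<open>w\<close> and \<open>x\<close>.\<close>
  have "neighbourhood G w \<inter> contaminated G S h \<subseteq> S ! h"
    using wi h by (auto simp: neighbourhood_def)
  then have w_cleared: "cleared_at G S i w" and x_cleared: "cleared_at G S i x"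
    using h xh wx by (auto simp: cleared_at_def neighbourhood_def)
  have "w \<in> contaminated G S (Suc i)"
    using xh(2) wx Si by auto
  then have wS: "w \<in> S ! Suc i"
    using shot_again[OF w_cleared, of "Suc i"] h by simp
  have K1: "K - {x} \<subseteq> contaminated G S (Suc i)"
    using clique_recontaminated[OF K x xh(2)] Si by simp
  obtain b where b: "b \<in> K" "b \<noteq> x"
  proof -
    have "card (K - {x}) \<noteq> 0"
      using card x by (simp add: card_Diff_singleton)
    then show ?thesis
      using that by (metis DiffE card.empty equals0I singletonI)
  qed
  have i1: "Suc i < length S"
    using winning_less_length[OF win] K1 b by blast
  have finS1: "finite (S ! Suc i)"
    by (rule finite_strategy_nth[OF S i1])
  \<comment> \<open>\<open>w\<close> and \<open>K - {x}\<close> together have \<open>card K\<close>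
    elements, one too many.\<close>
  have "\<not> insert w (K - {x}) \<subseteq> S ! Suc i"
  proof
    assume "insert w (K - {x}) \<subseteq> S ! Suc i"
    from card_mono[OF finS1 this] show False
      using small[OF i1] finK w(2) x by (simp add: card_Suc_Diff1)
  qed
  then obtain y where y: "y \<in> K" "y \<noteq> x" "y \<notin> S ! Suc i"
    using wS by blast
  have y1: "y \<in> contaminated G S (Suc i)"
    using K1 y by blast
  have K2: "K - {y} \<subseteq> contaminated G S (Suc (Suc i))"
    by (rule clique_recontaminated[OF K y(1) y1 y(3)])
  have i2: "Suc (Suc i) < length S"
    using winning_less_length[OF win] K2 x y(2) by blast
  have finS2: "finite (S ! Suc (Suc i))"
    by (rule finite_strategy_nth[OF S i2])
  \<comment> \<open>\<open>x\<close> was cleared in round \<open>i\<close> and the rest of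
    \<open>K\<close> by the shot \<open>S ! i\<close>, so monotonicity forces shooting whatever part
    of \<open>K\<close> is contaminated again.\<close>
  have K_shot: "v \<in> S ! Suc (Suc i)" if "v \<in> K" "v \<in> contaminated G S (Suc (Suc i))" for v
  proof (cases "v = x")
    case True
    then show ?thesis
      using shot_again[OF x_cleared, of "Suc (Suc i)"] that h by simp
  next
    case False
    then have "cleared_at G S (Suc i) v"
      using Si that by (simp add: cleared_at_def)
    then show ?thesis
      using shot_again[of "Suc i" v "Suc (Suc i)"] that by simp
  qed
  then have KS2: "K - {y} \<subseteq> S ! Suc (Suc i)"
    using K2 by blast
  have "card (S ! Suc (Suc i)) \<le> card (K - {y})"
    using small[OF i2] y(1) finK by simp
  then have S2: "S ! Suc (Suc i) = K - {y}"
    using card_seteq[OF finS2 KS2] by simp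
  have y2: "y \<notin> contaminated G S (Suc (Suc i))"
    using K_shot y(1) S2 by blast
  \<comment> \<open>Any other survivor of this shot would recontaminate \<open>y\<close>.\<close>
  have S1: "K - {x, y} \<subseteq> S ! Suc i"
  proof
    fix u assume u: "u \<in> K - {x, y}"
    show "u \<in> S ! Suc i"
    proof (rule ccontr)
      assume "u \<notin> S ! Suc i"
      then have "K - {u} \<subseteq> contaminated G S (Suc (Suc i))"
        using clique_recontaminated[OF K, of u S "Suc i"] K1 u by blast
      then show False
        using y2 y(1) u by blast
    qed
  qed
  obtain z where z: "(y, z) \<in> parcs G" "z \<notin> K"
    using out[OF y(1)] by blast
  have zy: "(z, y) \<in> parcs G"
    using z(1) by (rule arcs_symmetric)
  have z2: "z \<in> contaminated G S (Suc (Suc i))"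
    by (rule contaminated_SucI[OF y1 y(3) zy])
  have zS2: "z \<notin> S ! Suc (Suc i)"
    using S2 z(2) by simp
  have "z \<noteq> w"
    using shot_again[OF w_cleared, of "Suc (Suc i)"] h z2 zS2 by auto
  \<comment> \<open>The set \<open>K - {x, y}\<close> together with \<open>w\<close> and
    \<open>z\<close> would again have \<open>card K\<close> elements.\<close>
  have "z \<notin> S ! Suc i"
  proof
    assume "z \<in> S ! Suc i"
    then have "insert z (insert w (K - {x, y})) \<subseteq> S ! Suc i"
      using S1 wS by blast
    from card_mono[OF finS1 this] have "card K \<le> card (S ! Suc i)"
      using finK w(2) z(2) \<open>z \<noteq> w\<close> x y(1,2) card by (simp add: card_Diff_subset)
    then show False
      using small[OF i1] by simp
  qed
  \<comment> \<open>A contaminated \<open>z\<close> that is not shot would contaminate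
    \<open>y\<close>. So \<open>z\<close> is clean although its neighbour \<open>y\<close> was
    contaminated one round earlier: round \<open>Suc i\<close> cleared it.\<close>
  then have "z \<notin> contaminated G S (Suc i)"
    using contaminated_SucI[of z S "Suc i" y] z(1) y2 by blast
  then have "neighbourhood G z \<inter> contaminated G S i \<subseteq> S ! i"
    by (auto simp: neighbourhood_def)
  moreover have "y \<in> neighbourhood G z \<inter> contaminated G S i"
    using early[of i] y(1) zy by (auto simp: neighbourhood_def)
  ultimately have "cleared_at G S (Suc i) z"
    by (auto simp: cleared_at_def)
  then show False
    using shot_again[of "Suc i" z "Suc (Suc i)"] z2 zS2 by simp
qed

subsection \<open>Sweeping an interval model\<close>

text \<open>Suppose \<open>v\<close> is contaminated and not shot at \<open>j\<close>, and let
  \<open>y\<close> be the neighbour that contaminated it. By hypothesis neither was shot before, so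
  they have kept each other contaminated throughout, and no earlier round cleared
  \<open>v\<close>.\<close>

lemma monotone_strategyI:
  assumes fresh: "\<And>j s x. \<lbrakk>j < length S; x \<in> contaminated G S j; x \<notin> S ! j; s \<le> j\<rbrakk> \<Longrightarrow> x \<notin> S ! s"
  shows "monotone_strategy G S"
  unfolding monotone_strategy_def
proof (intro ballI impI allI, elim conjE, rule ccontr)
  fix v i j
  assume i: "i \<in> {1..length S}" and cleared: "cleared_at G S i v"
    and ij: "i < j" and j: "j < length S"
    and v: "v \<in> contaminated G S j" "v \<notin> S ! j"
  obtain h where h: "j = Suc h"
    using ij by (cases j) auto
  obtain y where y: "y \<in> contaminated G S h" "y \<notin> S ! h" "(v, y) \<in> parcs G"
    using v(1) h by auto
  have yv: "(y, v) \<in> parcs G"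
    using y(3) by (rule arcs_symmetric)
  have vf: "v \<notin> S ! s" if "s \<le> h" for s
    using fresh[OF j v] that h by simp
  have yf: "y \<notin> S ! s" if "s \<le> h" for s
    using fresh[OF _ y(1,2) that] j h by simp
  have both: "v \<in> contaminated G S s \<and> y \<in> contaminated G S s" if "s \<le> h" for s
    using that
  proof (induction s)
    case 0
    then show ?case
      using in_arcsD1[OF y(3)] in_arcsD2[OF y(3)] by simp
  next
    case (Suc s)
    then have "v \<in> contaminated G S s" "y \<in> contaminated G S s" "v \<notin> S ! s" "y \<notin> S ! s"
      using vf[of s] yf[of s] by simp_all
    then show ?case
      using contaminated_SucI[OF _ _ y(3)] contaminated_SucI[OF _ _ yv] by blast
  qed
  have ih: "i - 1 \<le> h"
    using ij h by simp
  have "y \<in> neighbourhood G v \<inter> contaminated G S (i - 1)"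
    using both[OF ih] y(3) by (simp add: neighbourhood_def)
  then show False
    using cleared vf[OF ih] yf[OF ih] unfolding cleared_at_def by blast
qed

text \<open>A discrete interval representation: \<open>v\<close> occupies the points from
  \<open>f v\<close> to \<open>l v\<close>, and the two inequalities say that two such intervals
  meet.\<close>

definition interval_model :: "nat \<Rightarrow> ('a \<Rightarrow> nat) \<Rightarrow> ('a \<Rightarrow> nat) \<Rightarrow> bool" where
  "interval_model m f l \<longleftrightarrow> (\<forall>v\<in>pverts G. f v \<le> l v \<and> l v < m) \<and>
     (\<forall>u\<in>pverts G. \<forall>v\<in>pverts G. u \<noteq> v \<longrightarrow> ((u, v) \<in> parcs G \<longleftrightarrow> f u \<le> l v \<and> f v \<le> l u))"

text \<open>For an interval model, the bags form a path decomposition into cliques.\<close>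

definition bag :: "('a \<Rightarrow> nat) \<Rightarrow> ('a \<Rightarrow> nat) \<Rightarrow> nat \<Rightarrow> 'a set" where
  "bag f l i = {v \<in> pverts G. f v \<le> i \<and> i \<le> l v}"

lemma interval_modelD:
  assumes "interval_model m f l" and "(u, v) \<in> parcs G"
  shows "f u \<le> l v" and "f v \<le> l u"
  using assms in_arcsD1[OF assms(2)] in_arcsD2[OF assms(2)] no_loops'[OF assms(2)]
  unfolding interval_model_def by auto

lemma bag_clique: "interval_model m f l \<Longrightarrow> clique G (bag f l i)"
  unfolding interval_model_def clique_def bag_def by fastforce

text \<open>Helly property on a line: the largest left end in \<open>K\<close> lies in every
  interval of \<open>K\<close>.\<close>

lemma clique_in_bag:
  assumes model: "interval_model m f l" and K: "clique G K" and ne: "K \<noteq> {}"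
  shows "\<exists>i<m. K \<subseteq> bag f l i"
proof -
  let ?i = "Max (f ` K)"
  have fin: "finite (f ` K)"
    using clique_finite[OF K] by simp
  then have "?i \<in> f ` K"
    using ne by simp
  then obtain u where u: "u \<in> K" "f u = ?i"
    by (metis imageE)
  have V: "\<And>v. v \<in> K \<Longrightarrow> v \<in> pverts G"
    using K by (auto simp: clique_def)
  have "f u \<le> l v" if "v \<in> K" for v
  proof (cases "u = v")
    case True
    then show ?thesis
      using model V[OF that] by (simp add: interval_model_def)
  next
    case False
    then have "(u, v) \<in> parcs G"
      using K u(1) that by (simp add: clique_def)
    then show ?thesis
      by (rule interval_modelD(1)[OF model])
  qed
  then have "K \<subseteq> bag f l ?i"
    using u(2) V Max_ge[OF fin] by (auto simp: bag_def)
  moreover have "?i < m"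
    using model V[OF u(1)] u(2) unfolding interval_model_def by (metis order_le_less_trans)
  ultimately show ?thesis
    by blast
qed

text \<open>
  Sweep over the bags, shooting each of them twice but sparing \<open>D\<close>. A vertex \<open>d \<in> D\<close> of the
  current bag survives the first shot, but all its neighbours are in the bag, so it is not
  contaminated afterwards, and the second shot hits whatever \<open>d\<close> contaminated.
\<close>

lemma sweep_strategy:
  assumes model: "interval_model m f l"
    and indep: "\<And>d e. \<lbrakk>d \<in> D; e \<in> D\<rbrakk> \<Longrightarrow> (d, e) \<notin> parcs G"
    and point: "\<And>d. d \<in> D \<Longrightarrow> f d = l d"
    and nonempty: "\<And>i. i < m \<Longrightarrow> bag f l i - D \<noteq> {}"
    and small: "\<And>i. i < m \<Longrightarrow> card (bag f l i - D) \<le> k"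
    and V: "pverts G \<noteq> {}"
  shows "\<exists>S. hunter_strategy G S \<and> winning G S \<and> monotone_strategy G S \<and> hunters_used S \<le> k"
proof -
  define T where "T i = bag f l i - D" for i
  define S where "S = map (\<lambda>j. T (j div 2)) [0..<2 * m]"
  have len: "length S = 2 * m"
    by (simp add: S_def)
  have nth: "S ! j = T (j div 2)" if "j < 2 * m" for j
    using that by (simp add: S_def)
  have ivl: "f v \<le> l v" "l v < m" if "v \<in> pverts G" for v
    using model that by (auto simp: interval_model_def)
  have m: "0 < m"
    using V ivl by fastforce
  have inV: "x \<in> pverts G" if "x \<in> contaminated G S j" for x j
    using contaminated_subset that by blast
  have survive1: "i < f x \<or> x \<in> D \<and> f x = i"
    if "i \<le> l x" "x \<notin> T i" "x \<in> pverts G" for i x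
  proof (cases "i < f x")
    case False
    then have "x \<in> D"
      using that by (simp add: T_def bag_def)
    with False show ?thesis
      using point that(1) by simp
  qed simp
  have survive2: "i < f x"
    if inv: "contaminated G S (2 * i) \<subseteq> {v. i \<le> l v}" and i: "i < m"
      and x: "x \<in> contaminated G S (Suc (2 * i))" "x \<notin> T i" for i x
  proof -
    obtain y where y: "y \<in> contaminated G S (2 * i)" "y \<notin> T i" "(x, y) \<in> parcs G"
      using x(1) nth[of "2 * i"] i by auto
    have xy: "f x \<le> l y" "f y \<le> l x"
      using interval_modelD[OF model y(3)] by auto
    \<comment> \<open>A spared point \<open>y\<close> at \<open>i\<close> would have its neighbour
      \<open>x\<close> in bag \<open>i\<close>; as \<open>D\<close> is independent, \<open>x\<close>
      is not spared, so the second shot hits it.\<close>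
    have "\<not> (y \<in> D \<and> f y = i)"
    proof
      assume d: "y \<in> D \<and> f y = i"
      then have "x \<in> T i"
        using xy point[of y] indep[of x y] y(3) inV[OF x(1)] by (auto simp: T_def bag_def)
      with x(2) show False ..
    qed
    then have "i < l x"
      using survive1[of i y] y inv inV[OF y(1)] xy(2) by auto
    then show ?thesis
      using survive1[of i x] x(2) inV[OF x(1)] point[of x] by fastforce
  qed
  \<comment> \<open>Sweep invariant: once all bags before \<open>i\<close> have been shot twice,
    only vertices reaching \<open>i\<close> or beyond are contaminated. For \<open>i = m\<close>
    there are none.\<close>
  have inv: "contaminated G S (2 * i) \<subseteq> {v. i \<le> l v}" if "i \<le> m" for i
    using that
  proof (induction i)
    case 0
    then show ?case by simp
  next
    case (Suc i)
    have "Suc i \<le> l x" if x: "x \<in> contaminated G S (Suc (Suc (2 * i)))" for x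
    proof -
      obtain y where y: "y \<in> contaminated G S (Suc (2 * i))" "y \<notin> T i" "(x, y) \<in> parcs G"
        using contaminated_SucE[OF x] nth[of "Suc (2 * i)"] Suc.prems by auto
      then show ?thesis
        using survive2[of i y] Suc interval_modelD(2)[OF model y(3)] by simp
    qed
    then show ?case by auto
  qed
  have "contaminated G S (2 * m) = {}"
    using inv[of m] inV ivl by fastforce
  then have "winning G S"
    by (simp add: winning_iff len)
  moreover have "hunter_strategy G S"
    using m nonempty by (auto simp: hunter_strategy_def S_def T_def bag_def)
  moreover have "hunters_used S \<le> k"
    using m small by (subst hunters_used_le_iff) (auto simp: S_def T_def)
  moreover have "monotone_strategy G S"
  proof (rule monotone_strategyI)
    fix j s x
    assume j: "j < length S" and x: "x \<in> contaminated G S j" "x \<notin> S ! j" and s: "s \<le> j"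
    define i where "i = j div 2"
    have i: "i < m" "s div 2 \<le> i"
      using j s len by (auto simp: i_def div_le_mono)
    have xT: "x \<notin> T i"
      using x(2) nth j len by (simp add: i_def)
    \<comment> \<open>A survivor lies wholly to the right of the bags shot so far or is always
      spared, so it has never been shot.\<close>
    have "i < f x \<or> x \<in> D"
    proof (cases "even j")
      case True
      then have "j = 2 * i"
        by (simp add: i_def)
      then show ?thesis
        using inv[of i] i survive1[of i x] x(1) xT inV by auto
    next
      case False
      then have "j = Suc (2 * i)"
        by (simp add: i_def odd_two_times_div_two_succ)
      then show ?thesis
        using survive2[of i x] inv[of i] i x(1) xT by auto
    qed
    then have "x \<notin> T (s div 2)"
      using i by (auto simp: T_def bag_def)
    then show "x \<notin> S ! s"
      using nth[of s] s j len by simp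
  qed
  ultimately show ?thesis
    by blast
qed

section \<open>From real intervals to integer intervals\<close>

text \<open>Keep one common point per arc and replace the reals by positions in the sorted list of
  these points; convexity makes each \<open>J v\<close> a run of consecutive positions. Every
  position comes from an arc, so its bag contains both ends of that arc.\<close>

lemma interval_model_exists:
  assumes "interval_graph G" and nbr: "\<And>v. v \<in> pverts G \<Longrightarrow> \<exists>u. (v, u) \<in> parcs G"
  obtains m f l where "interval_model m f l"
    and "\<And>i. i < m \<Longrightarrow> \<exists>u\<in>bag f l i. \<exists>v\<in>bag f l i. u \<noteq> v"
proof -
  obtain I where I: "interval_representation G I"
    using assms(1) by (auto simp: interval_graph_def)
  have "\<exists>p. \<forall>e\<in>parcs G. p e \<in> I (fst e) \<inter> I (snd e)"
  proof (rule bchoice, rule ballI)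
    fix e assume "e \<in> parcs G"
    then show "\<exists>y. y \<in> I (fst e) \<inter> I (snd e)"
      using I pair_no_loops arc_fst_in_verts arc_snd_in_verts
      unfolding interval_representation_def by (metis ex_in_conv prod.collapse)
  qed
  then obtain p where p: "\<And>e. e \<in> parcs G \<Longrightarrow> p e \<in> I (fst e) \<inter> I (snd e)"
    by blast
  define xs where "xs = sorted_list_of_set (p ` parcs G)"
  define m where "m = length xs"
  define J where "J v = {i. i < m \<and> xs ! i \<in> I v}" for v
  define f where "f v = Min (J v)" for v
  define l where "l v = Max (J v)" for v
  have set_xs: "set xs = p ` parcs G" and "sorted xs"
    using pair_finite_arcs by (auto simp: xs_def)
  have index: "\<exists>i. i \<in> J u \<and> i \<in> J v" if "(u, v) \<in> parcs G" for u v
  proof -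
    have "p (u, v) \<in> set xs"
      using that set_xs by blast
    then obtain i where "i < m" "xs ! i = p (u, v)"
      by (auto simp: in_set_conv_nth m_def)
    then show ?thesis
      using p[OF that] by (auto simp: J_def)
  qed
  have finJ: "finite (J v)" for v
    by (simp add: J_def)
  \<comment> \<open>An isolated vertex would contain none of the chosen points.\<close>
  have neJ: "J v \<noteq> {}" if "v \<in> pverts G" for v
    using nbr[OF that] index by blast
  have fJ: "f v \<in> J v" and lJ: "l v \<in> J v" if "v \<in> pverts G" for v
    using Min_in[OF finJ neJ[OF that]] Max_in[OF finJ neJ[OF that]] by (auto simp: f_def l_def)
  have J_range: "f v \<le> i \<and> i \<le> l v" if "i \<in> J v" for v i
    using that finJ[of v] by (simp add: f_def l_def)
  have convex: "i \<in> J v" if v: "v \<in> pverts G" and i: "f v \<le> i" "i \<le> l v" for v i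
  proof -
    have "i < m"
      using lJ[OF v] i by (simp add: J_def)
    then have "xs ! f v \<le> xs ! i" "xs ! i \<le> xs ! l v"
      using \<open>sorted xs\<close> i lJ[OF v] by (auto simp: J_def m_def sorted_iff_nth_mono)
    moreover have "xs ! f v \<in> I v" "xs ! l v \<in> I v" "is_interval (I v)"
      using fJ[OF v] lJ[OF v] I v by (auto simp: J_def interval_representation_def)
    ultimately have "xs ! i \<in> I v"
      unfolding is_interval_1 by blast
    then show ?thesis
      using \<open>i < m\<close> by (simp add: J_def)
  qed
  have "interval_model m f l"
    unfolding interval_model_def
  proof (intro conjI ballI impI)
    fix v assume v: "v \<in> pverts G"
    show "f v \<le> l v" "l v < m"
      using J_range[OF fJ[OF v]] lJ[OF v] by (auto simp: J_def)
  next
    fix u v assume u: "u \<in> pverts G" and v: "v \<in> pverts G" and "u \<noteq> v"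
    show "(u, v) \<in> parcs G \<longleftrightarrow> f u \<le> l v \<and> f v \<le> l u"
    proof
      assume "(u, v) \<in> parcs G"
      then obtain i where "i \<in> J u" "i \<in> J v"
        using index by blast
      then show "f u \<le> l v \<and> f v \<le> l u"
        using J_range order_trans by metis
    next
      assume cross: "f u \<le> l v \<and> f v \<le> l u"
      let ?i = "max (f u) (f v)"
      have "?i \<in> J u" "?i \<in> J v"
        using convex[OF u, of ?i] convex[OF v, of ?i] cross
          J_range[OF fJ[OF u]] J_range[OF fJ[OF v]] by auto
      then have "I u \<inter> I v \<noteq> {}"
        by (auto simp: J_def)
      then show "(u, v) \<in> parcs G"
        using I u v \<open>u \<noteq> v\<close> by (simp add: interval_representation_def)
    qed
  qed
  moreover have "\<exists>u\<in>bag f l i. \<exists>v\<in>bag f l i. u \<noteq> v" if i: "i < m" for i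
  proof -
    have "xs ! i \<in> p ` parcs G"
      using i set_xs nth_mem unfolding m_def by blast
    then obtain u v where uv: "(u, v) \<in> parcs G" "xs ! i = p (u, v)"
      by auto
    then have "i \<in> J u" "i \<in> J v"
      using p[OF uv(1)] i by (auto simp: J_def)
    then have "u \<in> bag f l i" "v \<in> bag f l i"
      using J_range in_arcsD1[OF uv(1)] in_arcsD2[OF uv(1)] by (auto simp: bag_def)
    then show ?thesis
      using no_loops'[OF uv(1)] by blast
  qed
  ultimately show ?thesis
    using that by blast
qed

text \<open>The first arc of a path to a second vertex. Connectivity is reachability in the
  symmetric closure, which adds no arcs here.\<close>

lemma connected_neighbour:
  assumes conn: "Digraph_Component.connected (with_proj G)" and card: "card (pverts G) \<noteq> 1"
    and v: "v \<in> pverts G"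
  shows "\<exists>u. (v, u) \<in> parcs G"
proof -
  obtain w where w: "w \<in> pverts G" "w \<noteq> v"
    using card v by (metis is_singletonI' is_singleton_altdef empty_iff)
  then have "(v, w) \<in> rtrancl_on (pverts G) (parcs (mk_symmetric (with_proj G)))"
    using conn v unfolding Digraph_Component.connected_def strongly_connected_def reachable_def
    by simp
  then obtain u where "(v, u) \<in> parcs (mk_symmetric (with_proj G))"
    using w(2) by (cases rule: converse_rtrancl_on_cases) auto
  then have "(v, u) \<in> parcs G"
    by (auto simp: parcs_mk_symmetric dest: arcs_symmetric)
  then show ?thesis ..
qed

section \<open>Simplicial vertices of maximum cliques and the upper bounds\<close>

text \<open>\<open>K\<close> always lies in the closed neighbourhood of \<open>v\<close>; if
  \<open>v\<close> is simplicial, that neighbourhood is a clique and hence no larger than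
  \<open>K\<close>. In particular a simplicial vertex lies in at most one maximum clique.\<close>

lemma closed_neighbourhood_simplicial:
  assumes K: "maximum_clique G K" and v: "v \<in> K"
  shows "simplicial G v \<longleftrightarrow> insert v (neighbourhood G v) = K"
proof
  have KV: "v \<in> pverts G" and Kc: "clique G K"
    using K v by (auto simp: maximum_clique_def clique_def)
  have sub: "K \<subseteq> insert v (neighbourhood G v)"
    using Kc v by (auto simp: clique_def neighbourhood_def)
  {
    assume "simplicial G v"
    then have N: "clique G (insert v (neighbourhood G v))"
      using KV by (auto simp: simplicial_def clique_def neighbourhood_def dest: arcs_symmetric)
    have "card (insert v (neighbourhood G v)) \<le> card K"
      using clique_card_le[OF N] K by (simp add: maximum_clique_def)
    then show "insert v (neighbourhood G v) = K"
      using card_seteq[OF clique_finite[OF N] sub] by simp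
  }
  {
    assume "insert v (neighbourhood G v) = K"
    then have "neighbourhood G v \<subseteq> K"
      by blast
    then show "simplicial G v"
      using Kc KV unfolding simplicial_def clique_def by auto
  }
qed

text \<open>
  One simplicial vertex is taken from each maximum clique; its interval can be shrunk to a single
  point, at which the bag is its closed neighbourhood.
\<close>

lemma monotone_upper_simplicial:
  assumes model: "interval_model m f l"
    and two: "\<And>i. i < m \<Longrightarrow> \<exists>u\<in>bag f l i. \<exists>v\<in>bag f l i. u \<noteq> v"
    and simp: "\<forall>K. maximum_clique G K \<longrightarrow> (\<exists>v\<in>K. simplicial G v)"
    and V: "pverts G \<noteq> {}"
  shows "\<exists>S. hunter_strategy G S \<and> winning G S \<and> monotone_strategy G S \<and>
    hunters_used S \<le> clique_number G - 1"
proof -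
  have "\<exists>d. \<forall>K. maximum_clique G K \<longrightarrow> d K \<in> K \<and> simplicial G (d K)"
    using simp by metis
  then obtain d where d: "\<And>K. maximum_clique G K \<Longrightarrow> d K \<in> K"
    "\<And>K. maximum_clique G K \<Longrightarrow> simplicial G (d K)"
    by blast
  have dN: "insert (d K) (neighbourhood G (d K)) = K" if "maximum_clique G K" for K
    using closed_neighbourhood_simplicial[OF that d(1)[OF that]] d(2)[OF that] by simp
  define D where "D = d ` {K. maximum_clique G K}"
  have DN: "maximum_clique G (insert v (neighbourhood G v))" "d (insert v (neighbourhood G v)) = v"
    if "v \<in> D" for v
    using that dN by (auto simp: D_def)
  \<comment> \<open>Adjacent \<open>v\<close> and \<open>w\<close> would have the same maximum
    clique as closed neighbourhood, but \<open>d\<close> picks only one vertex from it.\<close>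
  have indep: "(v, w) \<notin> parcs G" if v: "v \<in> D" and w: "w \<in> D" for v w
  proof
    assume vw: "(v, w) \<in> parcs G"
    let ?K = "insert v (neighbourhood G v)" and ?L = "insert w (neighbourhood G w)"
    have "w \<in> ?K" and K: "maximum_clique G ?K" and L: "maximum_clique G ?L"
      using vw DN(1) v w by (auto simp: neighbourhood_def)
    have "simplicial G w"
      using d(2)[OF L] DN(2)[OF w] by simp
    then have "?L = ?K"
      using closed_neighbourhood_simplicial[OF K \<open>w \<in> ?K\<close>] by simp
    then have "v = w"
      using DN(2)[OF v] DN(2)[OF w] by simp
    with vw show False
      using no_loops' by blast
  qed
  have DV: "D \<subseteq> pverts G"
    using d(1) by (auto simp: D_def maximum_clique_def clique_def)
  \<comment> \<open>Some bag contains this maximum clique and, being a clique itself, equals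
    it.\<close>
  have "\<exists>i. bag f l i = insert v (neighbourhood G v) \<and> i < m" if v: "v \<in> D" for v
  proof -
    let ?K = "insert v (neighbourhood G v)"
    have K: "clique G ?K" "card ?K = clique_number G"
      using DN(1)[OF v] by (auto simp: maximum_clique_def)
    then obtain i where i: "i < m" "?K \<subseteq> bag f l i"
      using clique_in_bag[OF model] by blast
    have "card (bag f l i) \<le> card ?K"
      using clique_card_le[OF bag_clique[OF model]] K(2) by simp
    then have "?K = bag f l i"
      using card_seteq[OF clique_finite[OF bag_clique[OF model]] i(2)] by simp
    then show ?thesis
      using i(1) by auto
  qed
  then obtain c where c: "\<And>v. v \<in> D \<Longrightarrow> bag f l (c v) = insert v (neighbourhood G v)"
    "\<And>v. v \<in> D \<Longrightarrow> c v < m"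
    by metis
  define f' where "f' v = (if v \<in> D then c v else f v)" for v
  define l' where "l' v = (if v \<in> D then c v else l v)" for v
  have c_arc: "(v, u) \<in> parcs G \<longleftrightarrow> f u \<le> c v \<and> c v \<le> l u"
    if "v \<in> D" "u \<in> pverts G" "u \<noteq> v" for u v
  proof -
    have "(v, u) \<in> parcs G \<longleftrightarrow> u \<in> bag f l (c v)"
      using that c(1)[OF that(1)] by (simp add: neighbourhood_def)
    then show ?thesis
      using that by (simp add: bag_def)
  qed
  \<comment> \<open>The bag at \<open>c v\<close> determines \<open>v\<close> through
    \<open>d\<close>, so distinct vertices of \<open>D\<close> shrink to distinct points and stay
    disjoint.\<close>
  have c_inj: "c v \<noteq> c w" if "v \<in> D" "w \<in> D" "v \<noteq> w" for v w
    using c(1)[OF that(1)] c(1)[OF that(2)] DN(2)[OF that(1)] DN(2)[OF that(2)] that(3) by metis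
  have sym: "(u, v) \<in> parcs G \<longleftrightarrow> (v, u) \<in> parcs G" for u v
    using arcs_symmetric by blast
  have model': "interval_model m f' l'"
    unfolding interval_model_def
  proof (intro conjI ballI impI)
    fix v assume v: "v \<in> pverts G"
    show "f' v \<le> l' v" "l' v < m"
      using model v c(2) by (auto simp: f'_def l'_def interval_model_def)
  next
    fix u v assume uv: "u \<in> pverts G" "v \<in> pverts G" "u \<noteq> v"
    consider "u \<in> D" "v \<in> D" | "u \<in> D" "v \<notin> D" | "u \<notin> D" "v \<in> D" | "u \<notin> D" "v \<notin> D"
      by blast
    then show "(u, v) \<in> parcs G \<longleftrightarrow> f' u \<le> l' v \<and> f' v \<le> l' u"
    proof cases
      case 1
      then show ?thesis
        using indep[OF 1] c_inj[OF 1 uv(3)] by (auto simp: f'_def l'_def)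
    next
      case 2
      then show ?thesis
        using c_arc[OF 2(1) uv(2)] uv(3) by (auto simp: f'_def l'_def)
    next
      case 3
      then show ?thesis
        using c_arc[OF 3(2) uv(1) uv(3)] sym[of u v] by (auto simp: f'_def l'_def)
    next
      case 4
      then show ?thesis
        using model uv by (simp add: f'_def l'_def interval_model_def)
    qed
  qed
  have bag_eq: "bag f' l' i - D = bag f l i - D" for i
    by (auto simp: bag_def f'_def l'_def)
  \<comment> \<open>The bag has two adjacent vertices, and the independent set \<open>D\<close>
    cannot contain both.\<close>
  have "bag f' l' i - D \<noteq> {}" if i: "i < m" for i
  proof -
    obtain u v where "u \<in> bag f l i" "v \<in> bag f l i" "(u, v) \<in> parcs G"
      using two[OF i] bag_clique[OF model] unfolding clique_def by metis
    then show ?thesis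
      unfolding bag_eq using indep by blast
  qed
  moreover have "card (bag f' l' i - D) \<le> clique_number G - 1" if "i < m" for i
  proof -
    let ?B = "bag f l i"
    have B: "clique G ?B" "finite ?B"
      using bag_clique[OF model] clique_finite by auto
    have le: "card (?B - D) \<le> card ?B" "card ?B \<le> clique_number G"
      using card_mono[OF B(2), of "?B - D"] clique_card_le[OF B(1)] by auto
    \<comment> \<open>A bag that is a maximum clique loses its chosen vertex \<open>d ?B\<close>;
      any other bag is already smaller.\<close>
    have "card (?B - D) < clique_number G"
    proof (cases "card ?B = clique_number G")
      case True
      then have max: "maximum_clique G ?B"
        using B(1) by (simp add: maximum_clique_def)
      have "d ?B \<in> ?B" "d ?B \<in> D"
        using d(1)[OF max] max by (auto simp: D_def)
      then have "?B - D \<subset> ?B"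
        by blast
      then show ?thesis
        using psubset_card_mono[OF B(2)] True by simp
    next
      case False
      then show ?thesis
        using le by simp
    qed
    then show ?thesis
      unfolding bag_eq by simp
  qed
  ultimately show ?thesis
    using indep by (intro sweep_strategy[OF model', of D, OF _ _ _ _ V]) (auto simp: f'_def l'_def)
qed

text \<open>The same sweep with no vertex spared; the bags are cliques.\<close>

lemma monotone_upper:
  assumes model: "interval_model m f l"
    and two: "\<And>i. i < m \<Longrightarrow> \<exists>u\<in>bag f l i. \<exists>v\<in>bag f l i. u \<noteq> v"
    and V: "pverts G \<noteq> {}"
  shows "\<exists>S. hunter_strategy G S \<and> winning G S \<and> monotone_strategy G S \<and>
    hunters_used S \<le> clique_number G"
  using two clique_card_le[OF bag_clique[OF model]]
  by (intro sweep_strategy[OF model, of "{}", OF _ _ _ _ V]) auto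

lemma clique_number_le_hunters_used:
  assumes "hunter_strategy G S" and "winning G S"
  shows "clique_number G - 1 \<le> hunters_used S"
  using hunters_used_ge_clique[OF _ assms] maximum_clique_exists
  unfolding maximum_clique_def by metis

end

section \<open>Exact values of the hunter numbers\<close>

theorem theorem4p7:
  fixes G :: "'a pair_pre_digraph"
  assumes "pair_graph G"
    and "Digraph_Component.connected (with_proj G)"
    and "interval_graph G"
  shows "((\<forall>K. maximum_clique G K \<longrightarrow> (\<exists>v\<in>K. simplicial G v)) \<longrightarrow>
            hunter_number G = monotone_hunter_number G \<and>
            monotone_hunter_number G = clique_number G - 1) \<and>
         (\<not> (\<forall>K. maximum_clique G K \<longrightarrow> (\<exists>v\<in>K. simplicial G v)) \<longrightarrow>
            monotone_hunter_number G = clique_number G)"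
proof -
  interpret pair_graph G by fact
  show ?thesis
  proof (cases "card (pverts G) = 1")
    \<comment> \<open>Both hunter numbers are \<open>0\<close> by convention. The only maximum
      clique is \<open>{x}\<close>, and \<open>x\<close> is simplicial, so the first alternative
      applies with clique number \<open>1\<close>.\<close>
    case True
    then obtain x where x: "pverts G = {x}"
      by (auto simp: card_1_singleton_iff)
    obtain K where K: "maximum_clique G K"
      using maximum_clique_exists by blast
    have no_arcs: "(u, v) \<notin> parcs G" for u v
      using x no_loops'[of u v] in_arcsD1[of u v] in_arcsD2[of u v] by auto
    have clx: "clique G {x}" and N: "neighbourhood G v = {}" for v
      using x no_arcs by (auto simp: clique_def neighbourhood_def)
    have max: "L = {x}" if L: "maximum_clique G L" for L
    proof -
      have "L \<subseteq> {x}" "1 \<le> card L"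
        using L clique_card_le[OF clx] x by (auto simp: maximum_clique_def clique_def)
      then show ?thesis
        by (auto dest: subset_singletonD)
    qed
    have "clique_number G = 1"
      using max[OF K] K by (simp add: maximum_clique_def)
    moreover have "\<forall>K. maximum_clique G K \<longrightarrow> (\<exists>v\<in>K. simplicial G v)"
      using max x N by (auto simp: simplicial_def clique_def)
    ultimately show ?thesis
      using True by (auto simp: hunter_number_def monotone_hunter_number_def)
  next
    case False
    have nbr: "\<exists>u. (v, u) \<in> parcs G" if "v \<in> pverts G" for v
      by (rule connected_neighbour[OF assms(2) False that])
    have V: "pverts G \<noteq> {}"
      using assms(2) by (auto simp: Digraph_Component.connected_def strongly_connected_def)
    obtain m f l where model: "interval_model m f l"
      and two: "\<And>i. i < m \<Longrightarrow> \<exists>u\<in>bag f l i. \<exists>v\<in>bag f l i. u \<noteq> v"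
      using interval_model_exists[OF assms(3) nbr] by metis
    show ?thesis
    proof (intro conjI impI)
      assume simp: "\<forall>K. maximum_clique G K \<longrightarrow> (\<exists>v\<in>K. simplicial G v)"
      obtain S where S: "hunter_strategy G S" "winning G S" "monotone_strategy G S"
        and used: "hunters_used S = clique_number G - 1"
        using monotone_upper_simplicial[OF model two simp V] clique_number_le_hunters_used
        by (metis order_antisym)
      \<comment> \<open>The monotone strategy \<open>S\<close> attains the lower bound valid for all
        winning strategies, so it settles both minima.\<close>
      have "hunter_number G = clique_number G - 1"
        unfolding hunter_number_def using False S used clique_number_le_hunters_used
        by (auto intro!: Least_equality)
      moreover show "monotone_hunter_number G = clique_number G - 1"
        unfolding monotone_hunter_number_def using False S used clique_number_le_hunters_used
        by (auto intro!: Least_equality)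
      ultimately show "hunter_number G = monotone_hunter_number G"
        by simp
    next
      assume "\<not> (\<forall>K. maximum_clique G K \<longrightarrow> (\<exists>v\<in>K. simplicial G v))"
      then obtain K where K: "maximum_clique G K" and nonsimp: "\<And>v. v \<in> K \<Longrightarrow> \<not> simplicial G v"
        by blast
      have Kc: "clique G K" "card K = clique_number G"
        using K by (auto simp: maximum_clique_def)
      have "\<exists>u. (v, u) \<in> parcs G \<and> u \<notin> K" if v: "v \<in> K" for v
      proof (rule ccontr)
        assume "\<not> ?thesis"
        then have "neighbourhood G v \<subseteq> K"
          by (auto simp: neighbourhood_def)
        moreover have "K \<subseteq> insert v (neighbourhood G v)"
          using Kc(1) v by (auto simp: clique_def neighbourhood_def)
        ultimately have "insert v (neighbourhood G v) = K"
          using v by auto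
        then show False
          using closed_neighbourhood_simplicial[OF K v] nonsimp[OF v] by simp
      qed
      then have lower: "clique_number G \<le> hunters_used S"
        if "hunter_strategy G S" "winning G S" "monotone_strategy G S" for S
        using hunters_used_ge_monotone[OF Kc(1) that] Kc(2) by simp
      then obtain S where "hunter_strategy G S" "winning G S" "monotone_strategy G S"
        "hunters_used S = clique_number G"
        using monotone_upper[OF model two V] by (metis order_antisym)
      then show "monotone_hunter_number G = clique_number G"
        unfolding monotone_hunter_number_def using False lower
        by (auto intro!: Least_equality)
    qed
  qed
qed

end
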